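(* Let $\mathbf{V}:\Theta\to\mathbb{R}^{N_h\times n}$, $\boldsymbol{\mu}\mapsto\mathbf{V}_{\boldsymbol{\mu}}$, be any DOD network, and let $\phi:\mathbb{R}^{p}\times\mathbb{R}^{p'}\to\mathbb{R}^{n}$ be any (measurable) map, called a reduced algorithm. Set $\mathbf{c}_{\boldsymbol{\mu},\boldsymbol{\nu}}:=\mathbf{V}_{\boldsymbol{\mu}}^{\top}\mathbb{G}\mathbf{u}_{\boldsymbol{\mu},\boldsymbol{\nu}}$ and $\mathbf{u}^{\mathrm{ROM}}_{\boldsymbol{\mu},\boldsymbol{\nu}}:=\mathbf{V}_{\boldsymbol{\mu}}\phi(\boldsymbol{\mu},\boldsymbol{\nu})$, and define $$\mathcal{E}_{A}:=\left(\mathbb{E}_{\boldsymbol{\mu},\boldsymbol{\nu}}\|\mathbf{u}_{\boldsymbol{\mu},\boldsymbol{\nu}}-\mathbf{u}^{\mathrm{ROM}}_{\boldsymbol{\mu},\boldsymbol{\nu}}\|^{2}\right)^{1/2},$$ $$\mathcal{E}_{\mathrm{DOD}}:=\left(\mathbb{E}_{\boldsymbol{\mu},\boldsymbol{\nu}}\|\mathbf{u}_{\boldsymbol{\mu},\boldsymbol{\nu}}-\mathbf{V}_{\boldsymbol{\mu}}\mathbf{V}_{\boldsymbol{\mu}}^{\top}\mathbb{G}\mathbf{u}_{\boldsymbol{\mu},\boldsymbol{\nu}}\|^{2}\right)^{1/2},\qquad \mathcal{E}_{\mathrm{coeff}}:=\left(\mathbb{E}_{\boldsymbol{\mu},\boldsymbol{\nu}}|\mathbf{c}_{\boldsymbol{\mu},\boldsymbol{\nu}}-\phi(\boldsymbol{\mu},\boldsymbol{\nu})|^{2}\right)^{1/2}.$$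 Then $$\mathcal{E}_{A}^{2}=\mathcal{E}_{\mathrm{DOD}}^{2}+\mathcal{E}_{\mathrm{coeff}}^{2}.$$
   Context: $\Theta\subset\mathbb{R}^{p}$ and $\Theta'\subset\mathbb{R}^{p'}$ are compact sets equipped with Borel probability distributions $\mathbb{P}$ and $\mathbb{Q}$, and $(\boldsymbol{\mu},\boldsymbol{\nu})\mapsto\mathbf{u}_{\boldsymbol{\mu},\boldsymbol{\nu}}\in\mathbb{R}^{N_h}$ is a measurable map on $\Theta\times\Theta'$. $\mathbb{G}\in\mathbb{R}^{N_h\times N_h}$ is symmetric positive definite, $\|\mathbf{u}\|:=\sqrt{\mathbf{u}^{\top}\mathbb{G}\mathbf{u}}$ on $\mathbb{R}^{N_h}$, and $|\cdot|$ is the Euclidean norm. $\mathbb{E}_{\boldsymbol{\mu},\boldsymbol{\nu}}$ of a nonnegative measurable function is its integral (in $[0,+\infty]$) against $\mathbb{P}\otimes\mathbb{Q}$. DOD network: fix integers $1\le n\le N_A\le N_h$ and a matrix $\mathbb{A}\in\mathbb{R}^{N_h\times N_A}$ with $\mathbb{A}^{\top}\mathbb{G}\mathbb{A}=\mathbb{I}$ (the case $N_A=N_h$ is allowed). A DOD network is a map of the form $\mathbf{V}_{\boldsymbol{\mu}}=\mathbb{A}\tilde{\mathbf{V}}_{\boldsymbol{\mu}}$ with $\tilde{\mathbf{V}}_{\boldsymbol{\mu}}=\mathrm{ORTH}([R_1(s(\boldsymbol{\mu})),\dots,R_n(s(\boldsymbol{\mu}))])\in\mathbb{R}^{N_A\times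 n}$, where $s:\mathbb{R}^p\to\mathbb{R}^l$ and $R_1,\dots,R_n:\mathbb{R}^l\to\mathbb{R}^{N_A}$ are feed-forward neural networks (continuous maps) such that the matrix $[R_1(s(\boldsymbol{\mu})),\dots,R_n(s(\boldsymbol{\mu}))]$ has full column rank for all $\boldsymbol{\mu}\in\Theta$, and ORTH is a fixed measurable map sending a full-column-rank matrix $\mathbb{W}\in\mathbb{R}^{N_A\times n}$ to a matrix $\tilde{\mathbb{W}}\in\mathbb{R}^{N_A\times n}$ with orthonormal columns (Euclidean sense) and the same column span (e.g. Gram–Schmidt). In particular $\mathbf{V}_{\boldsymbol{\mu}}^{\top}\mathbb{G}\mathbf{V}_{\boldsymbol{\mu}}=\mathbb{I}$ for all $\boldsymbol{\mu}\in\Theta$. *)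

theory Defs
  imports "HOL-Probability.Probability"
begin

definition spd_matrix :: "real^'h^'h \<Rightarrow> bool" where
  "spd_matrix G \<longleftrightarrow> transpose G = G \<and> (\<forall>x. x \<noteq> 0 \<longrightarrow> 0 < x \<bullet> (G *v x))"

definition G_norm :: "real^'h^'h \<Rightarrow> real^'h \<Rightarrow> real" where
  "G_norm G x = sqrt (x \<bullet> (G *v x))"

text \<open>
  Feed-forward networks have arbitrary finite depth and hidden widths. As the widths vary inside the
  definition, the hidden neurons of a layer are indexed by natural numbers: \<open>ff_hidden d h\<close> says that
  the functions \<open>\<lambda>x. h x j\<close> with \<open>j < d\<close> are the neurons of a hidden layer of width \<open>d\<close>
  (values at \<open>j \<ge> d\<close> are never used). Each layer, the output layer included, has its own continuous
  activation applied componentwise; the identity is allowed.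
\<close>

inductive ff_hidden :: "nat \<Rightarrow> (real^'a \<Rightarrow> nat \<Rightarrow> real) \<Rightarrow> bool" where
  first_layer: "continuous_on UNIV \<sigma> \<Longrightarrow> 0 < d \<Longrightarrow> ff_hidden d (\<lambda>x j. \<sigma> (w j \<bullet> x + b j))"
| next_layer: "ff_hidden d h \<Longrightarrow> continuous_on UNIV \<sigma> \<Longrightarrow> 0 < d' \<Longrightarrow>
    ff_hidden d' (\<lambda>x j. \<sigma> ((\<Sum>i<d. W j i * h x i) + b j))"

definition feedforward_nn :: "(real^'a \<Rightarrow> real^'b) \<Rightarrow> bool" where
  "feedforward_nn F \<longleftrightarrow> (\<exists>\<sigma>. continuous_on UNIV \<sigma> \<and>
     ((\<exists>W b. F = (\<lambda>x. \<chi> j. \<sigma> ((W *v x) $ j + b $ j))) \<or>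
      (\<exists>d h W b. ff_hidden d h \<and> F = (\<lambda>x. \<chi> j. \<sigma> ((\<Sum>i<d. W j i * h x i) + b j)))))"

lemma ff_hidden_continuous:
  "ff_hidden d h \<Longrightarrow> continuous_on UNIV (\<lambda>x. h x j)"
proof (induction arbitrary: j rule: ff_hidden.induct)
  case (first_layer \<sigma> d w b)
  have "continuous_on UNIV (\<lambda>x. w j \<bullet> x + b j)"
    by (intro continuous_intros)
  then show ?case
    by (rule continuous_on_compose2[OF first_layer(1)]) simp
next
  case (next_layer d h \<sigma> d' W b)
  have "continuous_on UNIV (\<lambda>x. (\<Sum>i<d. W j i * h x i) + b j)"
    by (intro continuous_intros next_layer.IH)
  then show ?case
    by (rule continuous_on_compose2[OF next_layer.hyps(2)]) simp
qed

lemma feedforward_nn_continuous: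
  assumes "feedforward_nn F"
  shows "continuous_on UNIV F"
proof -
  obtain \<sigma> where \<sigma>: "continuous_on UNIV \<sigma>" and
    F: "(\<exists>W b. F = (\<lambda>x. \<chi> j. \<sigma> ((W *v x) $ j + b $ j))) \<or>
     (\<exists>d h W b. ff_hidden d h \<and> F = (\<lambda>x. \<chi> j. \<sigma> ((\<Sum>i<d. W j i * h x i) + b j)))"
    using assms unfolding feedforward_nn_def by blast
  from F show ?thesis
  proof (elim disjE exE conjE)
    fix W b
    assume F: "F = (\<lambda>x. \<chi> j. \<sigma> ((W *v x) $ j + b $ j))"
    have "continuous_on UNIV (\<lambda>x. \<sigma> ((W *v x) $ j + b $ j))" for j
      by (rule continuous_on_compose2[OF \<sigma>])
         (intro continuous_intros matrix_vector_mult_linear_continuous_on, simp)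
    then show ?thesis
      unfolding F by (intro continuous_on_vec_lambda)
  next
    fix d h W b
    assume h: "ff_hidden d h" and F: "F = (\<lambda>x. \<chi> j. \<sigma> ((\<Sum>i<d. W j i * h x i) + b j))"
    have "continuous_on UNIV (\<lambda>x. \<sigma> ((\<Sum>i<d. W j i * h x i) + b j))" for j
      by (rule continuous_on_compose2[OF \<sigma>])
         (intro continuous_intros ff_hidden_continuous[OF h], simp)
    then show ?thesis
      unfolding F by (intro continuous_on_vec_lambda)
  qed
qed

definition full_column_rank :: "real^'n^'m \<Rightarrow> bool" where
  "full_column_rank W \<longleftrightarrow> rank W = CARD('n)"

definition orthonormal_columns :: "real^'n^'m \<Rightarrow> bool" where
  "orthonormal_columns W \<longleftrightarrow>
     (\<forall>i j. column i W \<bullet> column j W = (if i = j then 1 else 0))"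

text \<open>Nothing is required of the orthonormalisation map outside the full-column-rank matrices.\<close>

definition orth_map :: "(real^'n^'m \<Rightarrow> real^'n^'m) \<Rightarrow> bool" where
  "orth_map ORTH \<longleftrightarrow>
     ORTH \<in> borel_measurable (restrict_space borel {W. full_column_rank W}) \<and>
     (\<forall>W. full_column_rank W \<longrightarrow>
        orthonormal_columns (ORTH W) \<and> span (columns (ORTH W)) = span (columns W))"

definition matrix_of_columns :: "('n \<Rightarrow> real^'m) \<Rightarrow> real^'n^'m" where
  "matrix_of_columns v = (\<chi> i j. v j $ i)"

text \<open>
  \<open>V\<close> is the DOD network on \<open>\<Theta>\<close> with ambient matrix \<open>A\<close>, seed network \<open>s\<close> and root
  networks \<open>R j\<close>. The latent dimension occurs as a type, so \<open>s\<close> and \<open>R\<close> are parameters of the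
  predicate rather than existentially bound in it.
\<close>

definition dod_network ::
  "(real^'p) set \<Rightarrow> real^'m^'h \<Rightarrow> (real^'n^'m \<Rightarrow> real^'n^'m) \<Rightarrow>
   (real^'p \<Rightarrow> real^'l) \<Rightarrow> ('n \<Rightarrow> real^'l \<Rightarrow> real^'m) \<Rightarrow>
   (real^'p \<Rightarrow> real^'n^'h) \<Rightarrow> bool" where
  "dod_network \<Theta> A ORTH s R V \<longleftrightarrow>
     feedforward_nn s \<and> (\<forall>j. feedforward_nn (R j)) \<and>
     (\<forall>\<mu>\<in>\<Theta>. full_column_rank (matrix_of_columns (\<lambda>j. R j (s \<mu>)))) \<and>
     (\<forall>\<mu>\<in>\<Theta>. V \<mu> = A ** ORTH (matrix_of_columns (\<lambda>j. R j (s \<mu>))))"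

text \<open>A Borel probability distribution on \<open>\<Theta>\<close>; its underlying space is \<open>\<Theta>\<close> itself.\<close>

definition borel_prob_on :: "'a::topological_space set \<Rightarrow> 'a measure \<Rightarrow> bool" where
  "borel_prob_on \<Theta> P \<longleftrightarrow> prob_space P \<and> sets P = sets (restrict_space borel \<Theta>)"

definition sqrt_ennreal :: "ennreal \<Rightarrow> ennreal" where
  "sqrt_ennreal x = (if x = top then top else ennreal (sqrt (enn2real x)))"

definition coeff ::
  "real^'h^'h \<Rightarrow> ('a \<Rightarrow> real^'n^'h) \<Rightarrow> ('a \<Rightarrow> 'b \<Rightarrow> real^'h) \<Rightarrow> 'a \<Rightarrow> 'b \<Rightarrow> real^'n" where
  "coeff G V u \<mu> \<nu> = transpose (V \<mu>) *v (G *v u \<mu> \<nu>)"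

definition u_ROM ::
  "('a \<Rightarrow> real^'n^'h) \<Rightarrow> ('a \<Rightarrow> 'b \<Rightarrow> real^'n) \<Rightarrow> 'a \<Rightarrow> 'b \<Rightarrow> real^'h" where
  "u_ROM V \<phi> \<mu> \<nu> = V \<mu> *v \<phi> \<mu> \<nu>"

definition E_A ::
  "'a measure \<Rightarrow> 'b measure \<Rightarrow> real^'h^'h \<Rightarrow> ('a \<Rightarrow> 'b \<Rightarrow> real^'h) \<Rightarrow>
   ('a \<Rightarrow> real^'n^'h) \<Rightarrow> ('a \<Rightarrow> 'b \<Rightarrow> real^'n) \<Rightarrow> ennreal" where
  "E_A P Q G u V \<phi> = sqrt_ennreal
     (\<integral>\<^sup>+ (\<mu>, \<nu>). ennreal ((G_norm G (u \<mu> \<nu> - u_ROM V \<phi> \<mu> \<nu>))\<^sup>2) \<partial>(P \<Otimes>\<^sub>M Q))"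

definition E_DOD ::
  "'a measure \<Rightarrow> 'b measure \<Rightarrow> real^'h^'h \<Rightarrow> ('a \<Rightarrow> 'b \<Rightarrow> real^'h) \<Rightarrow>
   ('a \<Rightarrow> real^'n^'h) \<Rightarrow> ennreal" where
  "E_DOD P Q G u V = sqrt_ennreal
     (\<integral>\<^sup>+ (\<mu>, \<nu>). ennreal ((G_norm G
        (u \<mu> \<nu> - V \<mu> *v (transpose (V \<mu>) *v (G *v u \<mu> \<nu>))))\<^sup>2) \<partial>(P \<Otimes>\<^sub>M Q))"

definition E_coeff ::
  "'a measure \<Rightarrow> 'b measure \<Rightarrow> real^'h^'h \<Rightarrow> ('a \<Rightarrow> 'b \<Rightarrow> real^'h) \<Rightarrow>
   ('a \<Rightarrow> real^'n^'h) \<Rightarrow> ('a \<Rightarrow> 'b \<Rightarrow> real^'n) \<Rightarrow> ennreal" where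
  "E_coeff P Q G u V \<phi> = sqrt_ennreal
     (\<integral>\<^sup>+ (\<mu>, \<nu>). ennreal ((norm (coeff G V u \<mu> \<nu> - \<phi> \<mu> \<nu>))\<^sup>2) \<partial>(P \<Otimes>\<^sub>M Q))"

end

theory Submission
  imports Defs
begin

text \<open>
  The identity is the Pythagorean theorem in the inner product \<open>x \<bullet> (G *v y)\<close>, integrated over the
  parameters. The columns of \<open>V \<mu>\<close> are orthonormal for this inner product: \<open>A\<close> turns the Euclidean
  inner product into it, and \<open>ORTH\<close> returns Euclidean orthonormal columns. So
  \<open>V \<mu> *v (transpose (V \<mu>) *v (G *v w))\<close> is the orthogonal projection of \<open>w\<close> onto the column space of
  \<open>V \<mu>\<close>, and the reduced-order error splits into the projection error and a vector
  \<open>V \<mu> *v (c - \<phi>)\<close> of that space, whose length is the Euclidean length of its coefficients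
  (\<open>pythagoras_projection\<close>).

  Splitting the integral of the sum takes measurability of both parts on the product space. This
  reduces to measurability of \<open>V\<close>, a composition of the continuous networks with the measurable
  orthonormalisation map (\<open>dod_network_measurable\<close>). Infinite errors are covered as well, since integrals
  and square roots are taken in the extended nonnegative reals.
\<close>

lemma sqrt_ennreal_power2: "(sqrt_ennreal x)\<^sup>2 = x"
proof (cases x)
  case (real r)
  then show ?thesis
    by (simp add: sqrt_ennreal_def ennreal_power)
next
  case top
  then show ?thesis
    by (simp add: sqrt_ennreal_def power2_eq_square)
qed

lemma G_norm_power2:
  assumes "spd_matrix G"
  shows "(G_norm G x)\<^sup>2 = x \<bullet> (G *v x)"
proof -
  have "0 \<le> x \<bullet> (G *v x)"
    using assms by (cases "x = 0") (auto simp: spd_matrix_def less_imp_le)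
  then show ?thesis
    by (simp add: G_norm_def)
qed

lemma transpose_mult_orthonormal_columns:
  assumes "orthonormal_columns W"
  shows "transpose W ** W = mat 1"
  using assms
  by (simp add: orthonormal_columns_def vec_eq_iff matrix_matrix_mult_def transpose_def
      column_def inner_vec_def mat_def)

lemma dod_network_G_orthonormal:
  assumes A: "transpose A ** G ** A = mat 1" and "orth_map ORTH"
    and "dod_network \<Theta> A ORTH s R V" and "\<mu> \<in> \<Theta>"
  shows "transpose (V \<mu>) ** G ** V \<mu> = mat 1"
proof -
  define W where "W = ORTH (matrix_of_columns (\<lambda>j. R j (s \<mu>)))"
  have V: "V \<mu> = A ** W" and W: "transpose W ** W = mat 1"
    using assms
    by (auto simp: dod_network_def orth_map_def W_def intro: transpose_mult_orthonormal_columns)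
  have "transpose (V \<mu>) ** G ** V \<mu> = transpose W ** (transpose A ** G ** A) ** W"
    by (simp add: V matrix_transpose_mul matrix_mul_assoc)
  then show ?thesis
    by (simp add: A W)
qed

text \<open>
  The residual \<open>w - V *v c\<close> is \<open>G\<close>-orthogonal to every column of \<open>V\<close>, hence to \<open>V *v (c - y)\<close>,
  and on the column space of \<open>V\<close> the \<open>G\<close>-norm is the Euclidean norm of the coefficients.
\<close>

lemma pythagoras_projection:
  fixes G :: "real^'h^'h" and V :: "real^'n^'h" and w :: "real^'h" and y :: "real^'n"
  assumes G: "spd_matrix G" and V: "transpose V ** G ** V = mat 1"
  defines "c \<equiv> transpose V *v (G *v w)"
  shows "(G_norm G (w - V *v y))\<^sup>2 = (G_norm G (w - V *v c))\<^sup>2 + (norm (c - y))\<^sup>2"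
proof -
  \<comment> \<open>Otherwise \<open>transpose V *v x\<close> turns into \<open>x v* V\<close>, to which the rewrite rules below do not apply.\<close>
  note transpose_matrix_vector [simp del]
  define r d where "r = w - V *v c" and "d = c - y"
  have sym: "a \<bullet> (G *v b) = (G *v a) \<bullet> b" for a b
    using G by (metis dot_lmul_matrix spd_matrix_def transpose_matrix_vector)
  have adj: "(V *v a) \<bullet> b = a \<bullet> (transpose V *v b)" for a b
    by (metis dot_lmul_matrix transpose_matrix_vector transpose_transpose)
  have VGV: "transpose V *v (G *v (V *v a)) = a" for a
    using V by (simp add: matrix_vector_mul_assoc matrix_mul_assoc)
  have residual: "transpose V *v (G *v r) = 0"
    by (simp add: r_def matrix_vector_mult_diff_distrib VGV c_def)
  then have orth: "(V *v d) \<bullet> (G *v r) = 0"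
    by (simp add: adj)
  have cross: "r \<bullet> (G *v (V *v d)) = 0"
    using orth sym[of r "V *v d"] by (simp add: inner_commute[of "G *v r"])
  have split: "w - V *v y = r + V *v d"
    by (simp add: r_def d_def matrix_vector_mult_diff_distrib)
  have "(w - V *v y) \<bullet> (G *v (w - V *v y)) = r \<bullet> (G *v r) + d \<bullet> d"
    unfolding split
    by (simp add: matrix_vector_right_distrib inner_add_left inner_add_right cross adj residual VGV)
  then show ?thesis
    by (simp add: G_norm_power2[OF G] power2_norm_eq_inner r_def d_def)
qed

lemma borel_measurable_matrix_vector_mult:
  fixes V :: "'a \<Rightarrow> real^'n^'h"
  assumes "V \<in> borel_measurable M" and "x \<in> borel_measurable M"
  shows "(\<lambda>\<omega>. V \<omega> *v x \<omega>) \<in> borel_measurable M"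
proof (rule borel_measurable_continuous_Pair[OF assms])
  show "continuous_on UNIV (\<lambda>z :: (real^'n^'h) \<times> (real^'n). fst z *v snd z)"
    unfolding matrix_vector_mult_def by (intro continuous_intros)
qed

lemma borel_measurable_transpose:
  fixes V :: "'a \<Rightarrow> real^'n^'h"
  assumes "V \<in> borel_measurable M"
  shows "(\<lambda>\<omega>. transpose (V \<omega>)) \<in> borel_measurable M"
proof (rule borel_measurable_continuous_on[OF _ assms])
  show "continuous_on UNIV (transpose :: real^'n^'h \<Rightarrow> real^'h^'n)"
    unfolding transpose_def by (intro continuous_intros)
qed

lemma dod_network_measurable:
  assumes orth: "orth_map ORTH" and dod: "dod_network \<Theta> A ORTH s R V"
  shows "V \<in> borel_measurable (restrict_space borel \<Theta>)"
proof -
  define W where "W = (\<lambda>\<mu>. matrix_of_columns (\<lambda>j. R j (s \<mu>)))"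
  have s: "continuous_on UNIV s" and R: "continuous_on UNIV (R j)" for j
    using dod by (auto simp: dod_network_def intro: feedforward_nn_continuous)
  have "continuous_on UNIV (\<lambda>\<mu>. R j (s \<mu>))" for j
    by (rule continuous_on_compose2[OF R s]) simp
  then have "continuous_on UNIV W"
    unfolding W_def matrix_of_columns_def by (intro continuous_intros)
  then have "W \<in> borel_measurable (restrict_space borel \<Theta>)"
    by (intro measurable_restrict_space1 borel_measurable_continuous_onI)
  \<comment> \<open>\<open>ORTH\<close> is assumed measurable only on the full-column-rank matrices, where \<open>W\<close> takes its values.\<close>
  then have "W \<in> restrict_space borel \<Theta> \<rightarrow>\<^sub>M restrict_space borel {W. full_column_rank W}"
    using dod by (intro measurable_restrict_space2) (auto simp: dod_network_def W_def space_restrict_space)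
  then have "(\<lambda>\<mu>. ORTH (W \<mu>)) \<in> borel_measurable (restrict_space borel \<Theta>)"
    using orth unfolding orth_map_def by (blast intro: measurable_compose)
  moreover have "continuous_on UNIV (\<lambda>X. A ** X)"
    unfolding matrix_matrix_mult_def by (intro continuous_intros)
  ultimately have AW: "(\<lambda>\<mu>. A ** ORTH (W \<mu>)) \<in> borel_measurable (restrict_space borel \<Theta>)"
    by (rule borel_measurable_continuous_on[rotated])
  have V: "V \<mu> = A ** ORTH (W \<mu>)" if "\<mu> \<in> space (restrict_space borel \<Theta>)" for \<mu>
    using dod that by (auto simp: dod_network_def W_def space_restrict_space)
  show ?thesis
    by (subst measurable_cong[OF V]) (simp_all add: AW)
qed

lemma borel_prob_on_space:
  assumes "borel_prob_on \<Theta> P"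
  shows "space P = \<Theta>"
  using sets_eq_imp_space_eq[of P "restrict_space borel \<Theta>"] assms
  by (simp add: borel_prob_on_def space_restrict_space)

text \<open>
  The identity map carries measurability with respect to the Borel sets of \<open>\<Theta> \<times> \<Theta>'\<close> over to the
  product \<open>\<sigma>\<close>-algebra; second countability, which makes the Borel sets of a product the product of
  the Borel sets, is what makes it measurable.
\<close>

lemma measurable_pair_borel_prob_on:
  fixes P :: "'a::second_countable_topology measure" and Q :: "'b::second_countable_topology measure"
  assumes P: "borel_prob_on \<Theta> P" and Q: "borel_prob_on \<Theta>' Q"
  shows "(\<lambda>z. z) \<in> P \<Otimes>\<^sub>M Q \<rightarrow>\<^sub>M restrict_space borel (\<Theta> \<times> \<Theta>')"
proof (rule measurable_restrict_space2)
  have "(\<lambda>x. x) \<in> borel_measurable P" "(\<lambda>x. x) \<in> borel_measurable Q"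
    using P Q by (auto simp: borel_prob_on_def measurable_restrict_space1 cong: measurable_cong_sets)
  then have "(\<lambda>z. (fst z, snd z)) \<in> P \<Otimes>\<^sub>M Q \<rightarrow>\<^sub>M borel \<Otimes>\<^sub>M borel"
    by (intro measurable_Pair measurable_compose[OF measurable_fst] measurable_compose[OF measurable_snd])
  then show "(\<lambda>z. z) \<in> borel_measurable (P \<Otimes>\<^sub>M Q)"
    by (simp add: borel_prod)
  show "(\<lambda>z. z) \<in> space (P \<Otimes>\<^sub>M Q) \<rightarrow> \<Theta> \<times> \<Theta>'"
    by (auto simp: space_pair_measure borel_prob_on_space[OF P] borel_prob_on_space[OF Q])
qed

theorem lemma3:
  fixes \<Theta> :: "(real^'p) set" and \<Theta>' :: "(real^'q) set"
    and P :: "(real^'p) measure" and Q :: "(real^'q) measure"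
    and u :: "real^'p \<Rightarrow> real^'q \<Rightarrow> real^'h"
    and G :: "real^'h^'h"
    and A :: "real^'m^'h"
    and ORTH :: "real^'n^'m \<Rightarrow> real^'n^'m"
    and s :: "real^'p \<Rightarrow> real^'l"
    and R :: "'n \<Rightarrow> real^'l \<Rightarrow> real^'m"
    and V :: "real^'p \<Rightarrow> real^'n^'h"
    and \<phi> :: "real^'p \<Rightarrow> real^'q \<Rightarrow> real^'n"
  assumes "compact \<Theta>" and "compact \<Theta>'"
    and "borel_prob_on \<Theta> P" and "borel_prob_on \<Theta>' Q"
    and "(\<lambda>(\<mu>, \<nu>). u \<mu> \<nu>) \<in> borel_measurable (restrict_space borel (\<Theta> \<times> \<Theta>'))"
    and "spd_matrix G"
    and "CARD('n) \<le> CARD('m)" and "CARD('m) \<le> CARD('h)"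
    and "transpose A ** G ** A = mat 1"
    and "orth_map ORTH"
    and "dod_network \<Theta> A ORTH s R V"
    and "(\<lambda>(\<mu>, \<nu>). \<phi> \<mu> \<nu>) \<in> borel_measurable borel"
  shows "(E_A P Q G u V \<phi>)\<^sup>2 = (E_DOD P Q G u V)\<^sup>2 + (E_coeff P Q G u V \<phi>)\<^sup>2"
proof -
  note P = assms(3) and Q = assms(4) and G = assms(6)
  let ?M = "P \<Otimes>\<^sub>M Q"
  note id_M = measurable_pair_borel_prob_on[OF P Q]
  have u: "(\<lambda>z. u (fst z) (snd z)) \<in> borel_measurable ?M"
    using measurable_compose[OF id_M assms(5)] by (simp add: case_prod_beta)
  have "(\<lambda>z. z) \<in> borel_measurable ?M"
    using id_M by (simp add: measurable_restrict_space2_iff)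
  then have \<phi>: "(\<lambda>z. \<phi> (fst z) (snd z)) \<in> borel_measurable ?M"
    using measurable_compose[OF _ assms(12)] by (simp add: case_prod_beta)
  have "V \<in> borel_measurable P"
    using dod_network_measurable[OF assms(10,11)] P
    by (simp add: borel_prob_on_def cong: measurable_cong_sets)
  then have V: "(\<lambda>z. V (fst z)) \<in> borel_measurable ?M"
    by (rule measurable_compose[OF measurable_fst])
  have Gx: "(\<lambda>z. G *v x z) \<in> borel_measurable ?M" if "x \<in> borel_measurable ?M" for x
    using that by (intro borel_measurable_matrix_vector_mult) simp_all
  have c: "(\<lambda>z. coeff G V u (fst z) (snd z)) \<in> borel_measurable ?M"
    unfolding coeff_def
    by (intro borel_measurable_matrix_vector_mult borel_measurable_transpose V Gx u)
  have r: "(\<lambda>z. u (fst z) (snd z) - V (fst z) *v coeff G V u (fst z) (snd z))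
      \<in> borel_measurable ?M"
    by (intro borel_measurable_diff borel_measurable_matrix_vector_mult V c u)
  let ?dod = "\<lambda>z. (G_norm G (u (fst z) (snd z) - V (fst z) *v coeff G V u (fst z) (snd z)))\<^sup>2"
  let ?co = "\<lambda>z. (norm (coeff G V u (fst z) (snd z) - \<phi> (fst z) (snd z)))\<^sup>2"
  have meas: "?dod \<in> borel_measurable ?M" "?co \<in> borel_measurable ?M"
    unfolding G_norm_power2[OF G] using r Gx[OF r] c \<phi> by measurable
  have "(E_A P Q G u V \<phi>)\<^sup>2
      = (\<integral>\<^sup>+ z. ennreal ((G_norm G (u (fst z) (snd z) - V (fst z) *v \<phi> (fst z) (snd z)))\<^sup>2) \<partial>?M)"
    by (simp add: E_A_def u_ROM_def sqrt_ennreal_power2 case_prod_beta')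
  also have "\<dots> = (\<integral>\<^sup>+ z. ennreal (?dod z) + ennreal (?co z) \<partial>?M)"
  proof (rule nn_integral_cong)
    fix z assume "z \<in> space ?M"
    then have "fst z \<in> \<Theta>"
      by (auto simp: space_pair_measure borel_prob_on_space[OF P])
    note VGV = dod_network_G_orthonormal[OF assms(9,10,11) this]
    show "ennreal ((G_norm G (u (fst z) (snd z) - V (fst z) *v \<phi> (fst z) (snd z)))\<^sup>2)
        = ennreal (?dod z) + ennreal (?co z)"
      unfolding pythagoras_projection[OF G VGV, of _ "\<phi> (fst z) (snd z)"]
      by (simp add: coeff_def)
  qed
  also have "\<dots> = (\<integral>\<^sup>+ z. ennreal (?dod z) \<partial>?M) + (\<integral>\<^sup>+ z. ennreal (?co z) \<partial>?M)"
    using meas by (intro nn_integral_add) simp_all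
  also have "\<dots> = (E_DOD P Q G u V)\<^sup>2 + (E_coeff P Q G u V \<phi>)\<^sup>2"
    by (simp add: E_DOD_def E_coeff_def sqrt_ennreal_power2 case_prod_beta' coeff_def)
  finally show ?thesis .
qed

end
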